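(* Let $(X,d)$ be a metric space with at least four points and let $A,B,C\in X$ be three fixed points. Put $a=d(B,C)$, $b=d(C,A)$, $c=d(A,B)$, and for $M\in X$ put $d_1=d(M,A)$, $d_2=d(M,B)$, $d_3=d(M,C)$, $\alpha_1(M)=4d_2^2d_3^2-\big(d_1^2-(d_2^2+d_3^2)\big)^2$ and $\beta_1(M)=d_2^2+d_3^2-d_1^2$. Then a point $M\in X$ fulfills $d_2+d_3-d_1\leq 0$ if and only if $\alpha_1(M)\leq 0$ and $\beta_1(M)\leq 0$. Moreover, if $(X,d)$ is a Ptolemaic metric space, then the set of points $M\in X$ fulfilling $d_2+d_3-d_1\leq 0$ is non-empty if and only if $b\geq a$ or $c\geq a$.
   Context: A metric space $(X,d)$ is called a Ptolemaic metric space if $d(x_1,x_2)\,d(x_3,x_4)\leq d(x_2,x_4)\,d(x_1,x_3)+d(x_1,x_4)\,d(x_2,x_3)$ for every $x_1,x_2,x_3,x_4\in X$. *)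

theory Defs
  imports "HOL-Analysis.Abstract_Metric_Spaces"
begin

definition ptolemaic_metric_space :: "'a set \<Rightarrow> ('a \<Rightarrow> 'a \<Rightarrow> real) \<Rightarrow> bool" where
  "ptolemaic_metric_space X d \<longleftrightarrow> Metric_space X d \<and>
     (\<forall>x1\<in>X. \<forall>x2\<in>X. \<forall>x3\<in>X. \<forall>x4\<in>X.
        d x1 x2 * d x3 x4 \<le> d x2 x4 * d x1 x3 + d x1 x4 * d x2 x3)"

definition alpha1 :: "('a \<Rightarrow> 'a \<Rightarrow> real) \<Rightarrow> 'a \<Rightarrow> 'a \<Rightarrow> 'a \<Rightarrow> 'a \<Rightarrow> real" where
  "alpha1 d A B C M =
     4 * (d M B)\<^sup>2 * (d M C)\<^sup>2 - ((d M A)\<^sup>2 - ((d M B)\<^sup>2 + (d M C)\<^sup>2))\<^sup>2"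

definition beta1 :: "('a \<Rightarrow> 'a \<Rightarrow> real) \<Rightarrow> 'a \<Rightarrow> 'a \<Rightarrow> 'a \<Rightarrow> 'a \<Rightarrow> real" where
  "beta1 d A B C M = (d M B)\<^sup>2 + (d M C)\<^sup>2 - (d M A)\<^sup>2"

end

theory Submission
  imports Defs
begin

text \<open>
  Write \<open>p, q, r\<close> for the distances from \<open>M\<close> to \<open>A, B, C\<close>. The first equivalence
  is algebra of nonnegative reals: \<open>q + r \<le> p\<close> squares to
  \<open>2 * q * r \<le> p\<^sup>2 - q\<^sup>2 - r\<^sup>2\<close>, and squaring once more gives \<open>\<alpha>\<^sub>1 \<le> 0\<close>, where the
  sign condition \<open>\<beta>\<^sub>1 \<le> 0\<close> is what makes the second squaring reversible.

  For the second equivalence, the vertices \<open>C\<close> and \<open>B\<close> themselves are solutions when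
  \<open>b \<ge> a\<close> and \<open>c \<ge> a\<close>, respectively. If instead \<open>BC\<close> is strictly the longest side,
  Ptolemy's inequality \<open>a * p \<le> b * q + c * r\<close> makes \<open>p\<close> at most a weighted sum of
  \<open>q\<close> and \<open>r\<close> with both weights \<open>b / a\<close> and \<open>c / a\<close> below \<open>1\<close>, so \<open>p < q + r\<close>
  unless \<open>q = r = 0\<close>, and the latter would force \<open>B = C\<close>.
\<close>

lemma add_le_iff_double_squaring:
  fixes p q r :: real
  assumes "0 \<le> p" "0 \<le> q" "0 \<le> r"
  shows "q + r \<le> p \<longleftrightarrow>
           4 * q\<^sup>2 * r\<^sup>2 - (p\<^sup>2 - (q\<^sup>2 + r\<^sup>2))\<^sup>2 \<le> 0 \<and> q\<^sup>2 + r\<^sup>2 - p\<^sup>2 \<le> 0"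
proof -
  define s where "s = p\<^sup>2 - (q\<^sup>2 + r\<^sup>2)"
  have "q + r \<le> p \<longleftrightarrow> (q + r)\<^sup>2 \<le> p\<^sup>2"
    using assms by (simp add: power_mono_iff)
  also have "\<dots> \<longleftrightarrow> 2 * q * r \<le> s"
    by (auto simp: s_def power2_sum)
  also have "\<dots> \<longleftrightarrow> (2 * q * r)\<^sup>2 \<le> s\<^sup>2 \<and> 0 \<le> s"
  proof
    have "0 \<le> 2 * q * r" using assms by simp
    then show "(2 * q * r)\<^sup>2 \<le> s\<^sup>2 \<and> 0 \<le> s" if "2 * q * r \<le> s"
      using that by (meson order_trans power_mono)
    show "2 * q * r \<le> s" if "(2 * q * r)\<^sup>2 \<le> s\<^sup>2 \<and> 0 \<le> s"
      using that power2_le_imp_le by blast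
  qed
  also have "\<dots> \<longleftrightarrow> 4 * q\<^sup>2 * r\<^sup>2 - s\<^sup>2 \<le> 0 \<and> q\<^sup>2 + r\<^sup>2 - p\<^sup>2 \<le> 0"
    by (auto simp: s_def power_mult_distrib)
  finally show ?thesis unfolding s_def .
qed

lemma ptolemaic_strict_triangle_if_longest_side:
  assumes ptolemaic: "ptolemaic_metric_space X d"
    and "A \<in> X" "B \<in> X" "C \<in> X" "M \<in> X"
    and "d C A < d B C" "d A B < d B C"
  shows "d M A < d M B + d M C"
proof (rule ccontr)
  interpret Metric_space X d
    using ptolemaic by (simp add: ptolemaic_metric_space_def)
  \<comment> \<open>Of the three pairings of \<open>A, B, C, M\<close>, the one containing the longest side \<open>BC\<close>
    has to stand on the smaller side of Ptolemy's inequality.\<close>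
  have "d A M * d B C \<le> d M C * d A B + d A C * d M B"
    using ptolemaic assms(2-5) unfolding ptolemaic_metric_space_def by blast
  then have ptolemy: "d B C * d M A \<le> d C A * d M B + d A B * d M C"
    by (simp add: commute mult.commute)
  have "0 < d B C"
    using nonneg[of C A] assms(6) by linarith
  then have "0 < d M B + d M C"
    using triangle[of B M C] assms(3-5) commute[of B M] by linarith
  then have "0 < d M B \<or> 0 < d M C"
    by linarith
  then have "d C A * d M B + d A B * d M C < d B C * d M B + d B C * d M C"
    using assms(6,7) nonneg[of M B] nonneg[of M C]
    by (metis add_less_le_mono add_le_less_mono mult_strict_right_mono
        mult_right_mono less_imp_le)
  moreover assume "\<not> d M A < d M B + d M C"
  then have "d B C * (d M B + d M C) \<le> d B C * d M A"
    using \<open>0 < d B C\<close> by simp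
  ultimately show False
    using ptolemy by (simp add: distrib_left)
qed

theorem theorem9:
  fixes X :: "'a set" and d :: "'a \<Rightarrow> 'a \<Rightarrow> real" and A B C :: 'a and a b c :: real
  assumes "Metric_space X d"
    and "infinite X \<or> card X \<ge> 4"
    and "A \<in> X" and "B \<in> X" and "C \<in> X"
    and "a = d B C" and "b = d C A" and "c = d A B"
  shows "(\<forall>M\<in>X. d M B + d M C - d M A \<le> 0 \<longleftrightarrow>
              alpha1 d A B C M \<le> 0 \<and> beta1 d A B C M \<le> 0) \<and>
         (ptolemaic_metric_space X d \<longrightarrow>
            ({M \<in> X. d M B + d M C - d M A \<le> 0} \<noteq> {} \<longleftrightarrow> b \<ge> a \<or> c \<ge> a))"
proof (intro conjI impI ballI)
  interpret Metric_space X d by fact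
  show "d M B + d M C - d M A \<le> 0 \<longleftrightarrow> alpha1 d A B C M \<le> 0 \<and> beta1 d A B C M \<le> 0" for M
    using add_le_iff_double_squaring[of "d M A" "d M B" "d M C"]
    by (simp add: alpha1_def beta1_def)
  assume ptolemaic: "ptolemaic_metric_space X d"
  show "{M \<in> X. d M B + d M C - d M A \<le> 0} \<noteq> {} \<longleftrightarrow> b \<ge> a \<or> c \<ge> a"
  proof
    assume "{M \<in> X. d M B + d M C - d M A \<le> 0} \<noteq> {}"
    then obtain M where "M \<in> X" "d M B + d M C \<le> d M A"
      by auto
    then show "b \<ge> a \<or> c \<ge> a"
      using ptolemaic_strict_triangle_if_longest_side[OF ptolemaic assms(3-5)] assms(6-8)
      by (meson not_le)
  next
    assume "b \<ge> a \<or> c \<ge> a"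
    \<comment> \<open>The candidates are \<open>M = C\<close> for \<open>b \<ge> a\<close> and \<open>M = B\<close> for \<open>c \<ge> a\<close>.\<close>
    then have "d C B + d C C - d C A \<le> 0 \<or> d B B + d B C - d B A \<le> 0"
      using assms(3-8) commute[of C B] commute[of B A] by simp
    then show "{M \<in> X. d M B + d M C - d M A \<le> 0} \<noteq> {}"
      using assms(4,5) by blast
  qed
qed

end
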